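(* If $G$ is a split graph, then $\gamma_f(G)\le\gamma_f^\infty(G)\le 1+\gamma_f(G)$.
   Context: All graphs are finite, simple and undirected. A split graph is a graph whose vertex set can be partitioned into a clique and an independent set. $N(v)$ is the open neighbourhood and $N[v]=N(v)\cup\{v\}$ the closed neighbourhood of $v$. A fractional dominating function of $G=(V,E)$ is a function $w:V\to[0,\infty)$ with $\sum_{x\in N[v]}w(x)\ge 1$ for all $v\in V$; its total weight is $\sum_{x\in V}w(x)$, and $\gamma_f(G)$ is the smallest total weight of a fractional dominating function of $G$. Fractional eternal domination. Fix $S$. The defender chooses a fractional dominating function $w_1$ of total weight at most $S$. In each round $i\ge 1$ the attacker, who may choose attacks adaptively, attacks a vertex $v_i\in V$, and the defender chooses amounts $m_{xy,i}\ge 0$ for all $x\in V$, $y\in N(x)$, with $\sum_{y\in N(x)}m_{xy,i}\le w_i(x)$, and sets $w_{i+1}(x)=w_i(x)-\sum_{y\in N(x)}m_{xy,i}+\sum_{y\in N(x)}m_{yx,i}$. It is required that $w_{i+1}$ be a fractional dominating function and $w_{i+1}(v_i)\ge 1$. If the defender can respond in this way to every infinite sequence of attacks, $G$ can be eternally $S$-fractionally dominated. $\gamma_f^\infty(G)$ is the infimum of all $S$ for which $G$ can be eternally $S$-fractionally dominated. *)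

theory Defs
  imports "HOL-Analysis.Analysis" "Graph_Theory.Pair_Digraph"
begin

text \<open>
  A finite simple undirected graph is a \<open>pair_graph\<close>: finitely many vertices, and a symmetric,
  irreflexive relation \<open>parcs G\<close> on them, so an undirected edge is a pair of opposite arcs.
\<close>

definition split_graph :: "'a pair_pre_digraph \<Rightarrow> bool" where
  "split_graph G \<longleftrightarrow>
     (\<exists>K I. K \<union> I = pverts G \<and> K \<inter> I = {} \<and>
        (\<forall>x\<in>K. \<forall>y\<in>K. x \<noteq> y \<longrightarrow> (x, y) \<in> parcs G) \<and>
        (\<forall>x\<in>I. \<forall>y\<in>I. (x, y) \<notin> parcs G))"

definition open_nbhd :: "'a pair_pre_digraph \<Rightarrow> 'a \<Rightarrow> 'a set" where
  "open_nbhd G v = {u. (v, u) \<in> parcs G}"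

definition closed_nbhd :: "'a pair_pre_digraph \<Rightarrow> 'a \<Rightarrow> 'a set" where
  "closed_nbhd G v = insert v (open_nbhd G v)"

text \<open>Values of a weight function outside \<open>pverts G\<close> are irrelevant throughout.\<close>

definition frac_dominating :: "'a pair_pre_digraph \<Rightarrow> ('a \<Rightarrow> real) \<Rightarrow> bool" where
  "frac_dominating G w \<longleftrightarrow>
     (\<forall>x\<in>pverts G. 0 \<le> w x) \<and> (\<forall>v\<in>pverts G. (\<Sum>x\<in>closed_nbhd G v. w x) \<ge> 1)"

definition total_weight :: "'a pair_pre_digraph \<Rightarrow> ('a \<Rightarrow> real) \<Rightarrow> real" where
  "total_weight G w = (\<Sum>x\<in>pverts G. w x)"

text \<open>The minimum exists by compactness; see \<open>frac_dom_number_attained\<close> below.\<close>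

definition frac_dom_number :: "'a pair_pre_digraph \<Rightarrow> real" where
  "frac_dom_number G = (LEAST t. \<exists>w. frac_dominating G w \<and> total_weight G w = t)"

text \<open>
  \<open>m x y\<close> is the amount moved from \<open>x\<close> to \<open>y\<close>; only its values for adjacent \<open>x\<close> and \<open>y\<close> matter.
\<close>

definition legal_move ::
  "'a pair_pre_digraph \<Rightarrow> ('a \<Rightarrow> real) \<Rightarrow> ('a \<Rightarrow> 'a \<Rightarrow> real) \<Rightarrow> bool" where
  "legal_move G w m \<longleftrightarrow>
     (\<forall>x\<in>pverts G. \<forall>y\<in>open_nbhd G x. 0 \<le> m x y) \<and>
     (\<forall>x\<in>pverts G. (\<Sum>y\<in>open_nbhd G x. m x y) \<le> w x)"

definition apply_move ::
  "'a pair_pre_digraph \<Rightarrow> ('a \<Rightarrow> real) \<Rightarrow> ('a \<Rightarrow> 'a \<Rightarrow> real) \<Rightarrow> 'a \<Rightarrow> real" where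
  "apply_move G w m x =
     w x - (\<Sum>y\<in>open_nbhd G x. m x y) + (\<Sum>y\<in>open_nbhd G x. m y x)"

text \<open>
  A strategy \<open>\<sigma>\<close> of the defender maps the nonempty list of the attacks made so far (oldest first)
  to the amounts to be moved in response to the last of them. So the defender does not see future
  attacks. Since the strategy is fixed first, an adaptive attacker can do no more than
  produce some infinite sequence \<open>v\<close> of attacks, and quantifying over all sequences covers
  adaptive attacks.

  Rounds are numbered from 0: \<open>play G w \<sigma> v i\<close> is the weight function just before the
  attack on \<open>v i\<close>.
\<close>

definition response :: "('a list \<Rightarrow> 'a \<Rightarrow> 'a \<Rightarrow> real) \<Rightarrow> (nat \<Rightarrow> 'a) \<Rightarrow> nat \<Rightarrow> 'a \<Rightarrow> 'a \<Rightarrow> real" where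
  "response \<sigma> v i = \<sigma> (map v [0..<Suc i])"

primrec play ::
  "'a pair_pre_digraph \<Rightarrow> ('a \<Rightarrow> real) \<Rightarrow> ('a list \<Rightarrow> 'a \<Rightarrow> 'a \<Rightarrow> real) \<Rightarrow> (nat \<Rightarrow> 'a) \<Rightarrow>
     nat \<Rightarrow> 'a \<Rightarrow> real" where
  "play G w \<sigma> v 0 = w"
| "play G w \<sigma> v (Suc i) = apply_move G (play G w \<sigma> v i) (response \<sigma> v i)"

definition eternally_frac_dominated :: "'a pair_pre_digraph \<Rightarrow> real \<Rightarrow> bool" where
  "eternally_frac_dominated G S \<longleftrightarrow>
     (\<exists>w \<sigma>. frac_dominating G w \<and> total_weight G w \<le> S \<and>
        (\<forall>v. (\<forall>i. v i \<in> pverts G) \<longrightarrow>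
           (\<forall>i. legal_move G (play G w \<sigma> v i) (response \<sigma> v i) \<and>
                frac_dominating G (play G w \<sigma> v (Suc i)) \<and>
                play G w \<sigma> v (Suc i) (v i) \<ge> 1)))"

definition eternal_frac_dom_number :: "'a pair_pre_digraph \<Rightarrow> real" where
  "eternal_frac_dom_number G = Inf {S. eternally_frac_dominated G S}"


subsection \<open>Well-definedness\<close>

lemma finite_closed_nbhd: "pair_graph G \<Longrightarrow> finite (closed_nbhd G v)"
proof -
  assume "pair_graph G"
  then interpret pair_graph G .
  have "open_nbhd G v \<subseteq> snd ` parcs G" by (force simp: open_nbhd_def)
  then show ?thesis
    unfolding closed_nbhd_def using pair_finite_arcs by (simp add: finite_subset)
qed

lemma closed_nbhd_subset:
  "pair_graph G \<Longrightarrow> v \<in> pverts G \<Longrightarrow> closed_nbhd G v \<subseteq> pverts G"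
proof -
  assume "pair_graph G" and v: "v \<in> pverts G"
  then interpret pair_graph G by simp
  show ?thesis using v by (auto simp: closed_nbhd_def open_nbhd_def dest: in_arcsD2)
qed

lemma frac_dominating_one:
  assumes "pair_graph G"
  shows "frac_dominating G (\<lambda>_. 1)"
proof -
  have "card (closed_nbhd G v) \<ge> 1" for v
    using finite_closed_nbhd[OF assms, of v]
    by (simp add: Suc_le_eq card_gt_0_iff closed_nbhd_def)
  then show ?thesis
    unfolding frac_dominating_def using of_nat_mono[where 'a=real] by fastforce
qed

lemma frac_dominating_truncate:
  assumes G: "pair_graph G" and w: "frac_dominating G w"
  shows "frac_dominating G (\<lambda>x. if x \<in> pverts G then min 1 (w x) else 0)"
    (is "frac_dominating G ?u")
  unfolding frac_dominating_def
proof (intro conjI ballI)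
  fix x assume "x \<in> pverts G"
  then show "0 \<le> ?u x" using w by (auto simp: frac_dominating_def)
next
  fix v assume v: "v \<in> pverts G"
  have sub: "closed_nbhd G v \<subseteq> pverts G" by (rule closed_nbhd_subset[OF G v])
  have nonneg: "0 \<le> ?u x" for x using w by (auto simp: frac_dominating_def)
  show "1 \<le> (\<Sum>x\<in>closed_nbhd G v. ?u x)"
  proof (cases "\<exists>x\<in>closed_nbhd G v. w x \<ge> 1")
    case True
    then obtain x where x: "x \<in> closed_nbhd G v" "w x \<ge> 1" by blast
    then have "1 = ?u x" using sub by auto
    also have "\<dots> \<le> (\<Sum>x\<in>closed_nbhd G v. ?u x)"
      using x finite_closed_nbhd[OF G, of v] nonneg by (intro member_le_sum) auto
    finally show ?thesis .
  next
    case False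
    then have "(\<Sum>x\<in>closed_nbhd G v. ?u x) = (\<Sum>x\<in>closed_nbhd G v. w x)"
      using sub by (intro sum.cong) (auto simp: min_def)
    then show ?thesis using w v by (simp add: frac_dominating_def)
  qed
qed

lemma frac_dominating_minimal_exists:
  assumes G: "pair_graph G"
  shows "\<exists>w. frac_dominating G w \<and>
    (\<forall>w'. frac_dominating G w' \<longrightarrow> total_weight G w \<le> total_weight G w')"
proof -
  interpret pair_graph G by (rule G)
  define C :: "('a \<Rightarrow> real) set" where "C = (\<Pi>\<^sub>E x\<in>UNIV. {0..1})"
  define D where "D = (\<Inter>x\<in>pverts G. {w. 0 \<le> w x}) \<inter>
    (\<Inter>v\<in>pverts G. {w. (1::real) \<le> (\<Sum>x\<in>closed_nbhd G v. w x)})"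
  have D: "w \<in> D \<longleftrightarrow> frac_dominating G w" for w by (simp add: D_def frac_dominating_def)
  have "compactin (product_topology (\<lambda>_. euclidean) UNIV) C"
    unfolding C_def by (simp add: compactin_PiE)
  then have C: "compact C" by (simp add: euclidean_product_topology)
  have coord: "continuous_on UNIV (\<lambda>w::'a \<Rightarrow> real. w x)" for x
    by (rule continuous_on_product_coordinates)
  have "closed D"
    unfolding D_def
    by (intro closed_Int closed_INT ballI closed_Collect_le
        continuous_on_sum coord continuous_on_const)
  then have "compact (C \<inter> D)" using C by (rule compact_Int_closed[rotated])
  moreover have "(\<lambda>_. 1) \<in> C \<inter> D" using frac_dominating_one[OF G] by (simp add: D C_def PiE_UNIV_domain)
  moreover have "continuous_on (C \<inter> D) (total_weight G)"
    unfolding total_weight_def[abs_def]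
    by (intro continuous_on_sum continuous_on_subset[OF coord]) auto
  ultimately obtain w where w: "w \<in> C \<inter> D"
    and min: "\<And>u. u \<in> C \<inter> D \<Longrightarrow> total_weight G w \<le> total_weight G u"
    using continuous_attains_inf[of "C \<inter> D" "total_weight G"] by blast
  have "total_weight G w \<le> total_weight G w'" if w': "frac_dominating G w'" for w'
  proof -
    let ?u = "\<lambda>x. if x \<in> pverts G then min 1 (w' x) else 0"
    have "?u \<in> C \<inter> D"
      using frac_dominating_truncate[OF G w'] w' by (auto simp: D C_def PiE_UNIV_domain frac_dominating_def)
    then have "total_weight G w \<le> total_weight G ?u" by (rule min)
    also have "\<dots> \<le> total_weight G w'" unfolding total_weight_def by (intro sum_mono) auto
    finally show ?thesis .
  qed
  then show ?thesis using w D by blast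
qed

lemma frac_dom_number_attained:
  assumes "pair_graph G"
  shows "\<exists>w. frac_dominating G w \<and> total_weight G w = frac_dom_number G"
    and "frac_dominating G w' \<Longrightarrow> frac_dom_number G \<le> total_weight G w'"
proof -
  obtain w where w: "frac_dominating G w"
    "\<And>w'. frac_dominating G w' \<Longrightarrow> total_weight G w \<le> total_weight G w'"
    using frac_dominating_minimal_exists[OF assms] by blast
  have *: "frac_dom_number G = total_weight G w"
    unfolding frac_dom_number_def using w by (intro Least_equality) auto
  show "\<exists>w. frac_dominating G w \<and> total_weight G w = frac_dom_number G"
    using w * by auto
  show "frac_dom_number G \<le> total_weight G w'" if "frac_dominating G w'"
    using w(2)[OF that] * by simp
qed

lemma eternally_frac_dominated_card:
  assumes "pair_graph G"
  shows "eternally_frac_dominated G (real (card (pverts G)))"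
proof -
  have "play G (\<lambda>_. 1) (\<lambda>_ _ _. 0) v i = (\<lambda>_. 1)" for v i
    by (induction i) (auto simp: apply_move_def response_def)
  then show ?thesis
    unfolding eternally_frac_dominated_def using frac_dominating_one[OF assms]
    by (intro exI[of _ "\<lambda>_. 1"] exI[of _ "\<lambda>_ _ _. 0"])
      (auto simp: total_weight_def legal_move_def response_def simp del: play.simps)
qed

lemma bdd_below_eternally_frac_dominated: "bdd_below {S. eternally_frac_dominated G S}"
proof (rule bdd_belowI)
  fix S assume "S \<in> {S. eternally_frac_dominated G S}"
  then obtain w where "frac_dominating G w" "total_weight G w \<le> S"
    by (auto simp: eternally_frac_dominated_def)
  moreover have "0 \<le> total_weight G w"
    using \<open>frac_dominating G w\<close> by (auto simp: total_weight_def frac_dominating_def intro: sum_nonneg)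
  ultimately show "0 \<le> S" by simp
qed

end

theory Submission
  imports Defs
begin

text \<open>
  The lower bound holds because the defender's initial configuration is itself a fractional
  dominating function.

  For the upper bound, let \<open>K\<close> be the clique and \<open>I\<close> the independent set. A non-isolated vertex \<open>v\<close>
  of \<open>I\<close> satisfies \<open>N[v] \<subseteq> N[k]\<close> for each neighbour \<open>k \<in> K\<close>, so all weight on \<open>v\<close> may be given to
  one such \<open>k\<close>. Hence some optimal fractional dominating function \<open>w\<close> vanishes on the non-isolated
  vertices of \<open>I\<close> (\<open>frac_dominating_concentrated\<close>). The defender plays \<open>w\<close> plus one extra unit, the
  token, and keeps the invariant that the configuration is \<open>w\<close> with the token on some vertex \<open>u\<close>
  that lies in \<open>K\<close> or is a non-isolated vertex of \<open>I\<close>. An attacked isolated vertex of \<open>I\<close> carries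
  weight 1 already. For any other attacked vertex \<open>v\<close> the token is relocated from \<open>u\<close> to \<open>v\<close> in a
  single round, although \<open>u\<close> and \<open>v\<close> may be at distance three. If \<open>v \<in> I\<close>, then \<open>w\<close> vanishes on \<open>v\<close>,
  so the neighbours of \<open>v\<close> carry weight at least 1 and can send a unit to \<open>v\<close> at once. If \<open>u \<in> I\<close>,
  the token is handed to the neighbours of \<open>u\<close> at the same time. The gaps and surpluses that this
  leaves in \<open>K\<close> cancel by simultaneous moves inside the clique (\<open>token_relocation\<close>), so the round
  ends in \<open>w\<close> plus a token on \<open>v\<close>.
\<close>

section \<open>Strategies from an invariant set of configurations\<close>

text \<open>
  A strategy sees the list of attacks only. The current configuration can be recomputed from it by
  replaying the chosen responses, so a response that depends on the configuration suffices.
\<close>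

lemma eternally_frac_dominated_invariant:
  assumes w0: "w0 \<in> C" "total_weight G w0 \<le> S"
    and dom: "\<And>w. w \<in> C \<Longrightarrow> frac_dominating G w"
    and step: "\<And>w v. w \<in> C \<Longrightarrow> v \<in> pverts G \<Longrightarrow>
      \<exists>m. legal_move G w m \<and> apply_move G w m \<in> C \<and> apply_move G w m v \<ge> 1"
  shows "eternally_frac_dominated G S"
proof -
  obtain \<mu> where \<mu>: "\<And>w v. w \<in> C \<Longrightarrow> v \<in> pverts G \<Longrightarrow>
      legal_move G w (\<mu> w v) \<and> apply_move G w (\<mu> w v) \<in> C \<and> apply_move G w (\<mu> w v) v \<ge> 1"
    using step by metis
  define conf where "conf xs = fold (\<lambda>v w. apply_move G w (\<mu> w v)) xs w0" for xs
  define \<sigma> where "\<sigma> xs = \<mu> (conf (butlast xs)) (last xs)" for xs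
  have resp: "response \<sigma> v i = \<mu> (conf (map v [0..<i])) (v i)" for v i
    by (simp add: response_def \<sigma>_def)
  have play: "play G w0 \<sigma> v i = conf (map v [0..<i])" for v i
    by (induction i) (simp_all add: resp conf_def)
  have inC: "play G w0 \<sigma> v i \<in> C" if "\<And>i. v i \<in> pverts G" for v i
    using that w0(1) \<mu> by (induction i) (auto simp: resp play)
  have "legal_move G (play G w0 \<sigma> v i) (response \<sigma> v i) \<and>
        frac_dominating G (play G w0 \<sigma> v (Suc i)) \<and> play G w0 \<sigma> v (Suc i) (v i) \<ge> 1"
    if v: "\<And>i. v i \<in> pverts G" for v i
    using \<mu>[OF inC[of v i] v[of i]] dom[OF inC[of v "Suc i"]] v by (simp add: resp play)
  then show ?thesis
    unfolding eternally_frac_dominated_def using w0 dom by blast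
qed

lemma frac_dom_number_le_eternal_frac_dom_number:
  assumes "pair_graph G"
  shows "frac_dom_number G \<le> eternal_frac_dom_number G"
  unfolding eternal_frac_dom_number_def
proof (rule cInf_greatest)
  show "{S. eternally_frac_dominated G S} \<noteq> {}"
    using eternally_frac_dominated_card[OF assms] by blast
next
  fix S assume "S \<in> {S. eternally_frac_dominated G S}"
  then obtain w where "frac_dominating G w" "total_weight G w \<le> S"
    by (auto simp: eternally_frac_dominated_def)
  then show "frac_dom_number G \<le> S"
    using frac_dom_number_attained(2)[OF assms] by fastforce
qed

section \<open>Moves supported on the edges\<close>

lemma open_nbhd_subset:
  assumes "pair_graph G"
  shows "open_nbhd G v \<subseteq> pverts G"
proof -
  interpret pair_graph G by (rule assms)
  show ?thesis by (auto simp: open_nbhd_def dest: in_arcsD2)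
qed

lemma open_nbhd_sym:
  assumes "pair_graph G"
  shows "u \<in> open_nbhd G v \<longleftrightarrow> v \<in> open_nbhd G u"
proof -
  interpret pair_graph G by (rule assms)
  show ?thesis by (auto simp: open_nbhd_def arcs_symmetric)
qed

lemma finite_pverts: "pair_graph G \<Longrightarrow> finite (pverts G)"
proof -
  assume "pair_graph G"
  then interpret pair_graph G .
  show ?thesis by (rule pair_finite_verts)
qed

text \<open>
  When nothing moves between non-adjacent vertices, outflow and inflow may be summed over all
  vertices, and such sums split along the different kinds of transfer.
\<close>

lemma move_supported_on_edges:
  assumes G: "pair_graph G"
    and supp: "\<And>x y. m x y \<noteq> 0 \<Longrightarrow> y \<in> open_nbhd G x"
    and nonneg: "\<And>x y. 0 \<le> m x y"
    and out: "\<And>x. x \<in> pverts G \<Longrightarrow> (\<Sum>y\<in>pverts G. m x y) \<le> c x"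
  shows "legal_move G c m"
    and "apply_move G c m x = c x - (\<Sum>y\<in>pverts G. m x y) + (\<Sum>y\<in>pverts G. m y x)"
proof -
  have row: "(\<Sum>y\<in>open_nbhd G x. m x y) = (\<Sum>y\<in>pverts G. m x y)" for x
    using supp open_nbhd_subset[OF G] finite_pverts[OF G] by (intro sum.mono_neutral_left) auto
  have col: "(\<Sum>y\<in>open_nbhd G x. m y x) = (\<Sum>y\<in>pverts G. m y x)" for x
    using supp open_nbhd_subset[OF G] finite_pverts[OF G] open_nbhd_sym[OF G]
    by (intro sum.mono_neutral_left) auto
  show "legal_move G c m" using nonneg out by (simp add: legal_move_def row)
  show "apply_move G c m x = c x - (\<Sum>y\<in>pverts G. m x y) + (\<Sum>y\<in>pverts G. m y x)"
    by (simp add: apply_move_def row col)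
qed

section \<open>Relocating the token\<close>

text \<open>
  How a token at \<open>u\<close> is spread over the clique: \<open>a k\<close> is the amount that \<open>k\<close> takes over from \<open>u\<close>,
  or hands to \<open>u\<close> when the token arrives there. For \<open>u\<close> outside the clique the bound \<open>a \<le> w\<close> lets
  the clique pay out the share from \<open>w\<close> alone.
\<close>

definition token_share ::
  "'a pair_pre_digraph \<Rightarrow> 'a set \<Rightarrow> ('a \<Rightarrow> real) \<Rightarrow> 'a \<Rightarrow> ('a \<Rightarrow> real) \<Rightarrow> bool" where
  "token_share G K w u a \<longleftrightarrow>
     (\<forall>x. 0 \<le> a x) \<and> (\<forall>x. a x \<noteq> 0 \<longrightarrow> x \<in> K) \<and> (\<Sum>x\<in>pverts G. a x) = 1 \<and>
     (if u \<in> K then a = indicator {u}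
      else (\<forall>x. a x \<noteq> 0 \<longrightarrow> x \<in> open_nbhd G u) \<and> (\<forall>x\<in>pverts G. a x \<le> w x))"

lemma token_share_clique_vertex:
  assumes "pair_graph G" "K \<subseteq> pverts G" "u \<in> K"
  shows "token_share G K w u (indicator {u})"
proof -
  have "(\<Sum>x\<in>pverts G. indicator {u} x :: real) = 1"
    using assms finite_pverts[OF assms(1)] by (auto simp: indicator_def)
  then show ?thesis using assms(3) by (auto simp: token_share_def indicator_def)
qed

text \<open>
  As \<open>w\<close> vanishes at \<open>u\<close>, domination of \<open>u\<close> puts weight at least 1 on its neighbours, and
  scaling this weight down to total 1 gives a share below \<open>w\<close>.
\<close>

lemma token_share_independent_vertex:
  assumes G: "pair_graph G" and w: "frac_dominating G w"
    and u: "u \<in> pverts G" "u \<notin> K" "w u = 0" and nb: "open_nbhd G u \<subseteq> K"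
  shows "\<exists>a. token_share G K w u a"
proof -
  define W where "W = (\<Sum>x\<in>open_nbhd G u. w x)"
  define a where "a x = (if x \<in> open_nbhd G u then w x / W else 0)" for x
  have fin: "finite (open_nbhd G u)"
    using open_nbhd_subset[OF G] finite_pverts[OF G] by (rule finite_subset)
  have "u \<notin> open_nbhd G u" using nb u(2) by blast
  then have "(\<Sum>x\<in>closed_nbhd G u. w x) = W"
    using fin u(3) by (simp add: closed_nbhd_def W_def)
  then have W: "W \<ge> 1" using w u(1) by (fastforce simp: frac_dominating_def)
  have nonneg: "0 \<le> w x" if "x \<in> pverts G" for x using w that by (simp add: frac_dominating_def)
  have "(\<Sum>x\<in>pverts G. a x) = (\<Sum>x\<in>open_nbhd G u. w x / W)"
    unfolding a_def using open_nbhd_subset[OF G] finite_pverts[OF G]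
    by (subst sum.inter_restrict[symmetric]) (auto simp: Int_absorb1)
  also have "\<dots> = 1" using W by (simp add: W_def flip: sum_divide_distrib)
  finally have "(\<Sum>x\<in>pverts G. a x) = 1" .
  moreover have "0 \<le> a x" for x
    using W nonneg subsetD[OF open_nbhd_subset[OF G]]
    by (auto simp: a_def intro!: divide_nonneg_nonneg)
  moreover have "a x \<le> w x" if "x \<in> pverts G" for x
    using nonneg[OF that] W mult_right_mono[OF W nonneg[OF that]] by (auto simp: a_def field_simps)
  moreover have "x \<in> open_nbhd G u" if "a x \<noteq> 0" for x using that by (auto simp: a_def split: if_splits)
  ultimately have "token_share G K w u a" using nb u(2) by (auto simp: token_share_def)
  then show ?thesis by blast
qed

text \<open>
  Three transfers happen simultaneously: \<open>u\<close> hands out its share \<open>a\<close> if it lies outside the clique,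
  \<open>v\<close> collects its share \<open>b\<close> if it lies outside the clique, and the clique balances the difference
  of \<open>a\<close> and \<open>b\<close>. Balancing only the positive parts of this difference is what keeps the move
  legal: if \<open>v\<close> lies outside the clique, \<open>k\<close> sends \<open>b k\<close> to \<open>v\<close> and \<open>max 0 (a k - b k)\<close> into the
  clique, which is \<open>max (a k) (b k)\<close> in all and hence never more than \<open>k\<close> holds at the beginning
  of the round.
\<close>

lemma token_relocation:
  assumes G: "pair_graph G" and K: "K \<subseteq> pverts G"
    and clique: "\<And>x y. x \<in> K \<Longrightarrow> y \<in> K \<Longrightarrow> x \<noteq> y \<Longrightarrow> y \<in> open_nbhd G x"
    and w: "\<And>x. x \<in> pverts G \<Longrightarrow> 0 \<le> w x"
    and u: "u \<in> pverts G" "token_share G K w u a"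
    and v: "v \<in> pverts G" "token_share G K w v b"
  shows "\<exists>m. legal_move G (\<lambda>x. w x + indicator {u} x) m \<and>
    apply_move G (\<lambda>x. w x + indicator {u} x) m = (\<lambda>x. w x + indicator {v} x)"
proof -
  let ?V = "pverts G"
  define P where "P x = max 0 (a x - b x)" for x
  define Q where "Q x = max 0 (b x - a x)" for x
  define D where "D = (\<Sum>x\<in>?V. P x)"
  define m where "m x y =
    (if x = u \<and> u \<notin> K then a y else 0) + (if y = v \<and> v \<notin> K then b x else 0) + P x * Q y / D" for x y
  note fin = finite_pverts[OF G]
  have a: "0 \<le> a x" "a x \<noteq> 0 \<Longrightarrow> x \<in> K" "sum a ?V = 1" "u \<in> K \<Longrightarrow> a x = indicator {u} x"
    "u \<notin> K \<Longrightarrow> a x \<noteq> 0 \<Longrightarrow> x \<in> open_nbhd G u" "u \<notin> K \<Longrightarrow> x \<in> ?V \<Longrightarrow> a x \<le> w x" for x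
    using u(2) by (auto simp: token_share_def split: if_splits)
  have b: "0 \<le> b x" "b x \<noteq> 0 \<Longrightarrow> x \<in> K" "sum b ?V = 1" "v \<in> K \<Longrightarrow> b x = indicator {v} x"
    "v \<notin> K \<Longrightarrow> b x \<noteq> 0 \<Longrightarrow> x \<in> open_nbhd G v" "v \<notin> K \<Longrightarrow> x \<in> ?V \<Longrightarrow> b x \<le> w x" for x
    using v(2) by (auto simp: token_share_def split: if_splits)
  have PQ: "Q x - P x = b x - a x" "0 \<le> P x" "0 \<le> Q x" for x by (auto simp: P_def Q_def)
  have "(\<Sum>x\<in>?V. Q x - P x) = 0" by (simp add: PQ(1) sum_subtractf a(3) b(3))
  then have D': "(\<Sum>x\<in>?V. Q x) = D" by (simp add: sum_subtractf D_def)
  have D0: "0 \<le> D" unfolding D_def by (intro sum_nonneg PQ)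
  \<comment> \<open>Division by \<open>D\<close> is harmless: if \<open>D = 0\<close> there is nothing to balance.\<close>
  have P0: "P x = 0" if "D = 0" "x \<in> ?V" for x
    using that fin PQ unfolding D_def by (simp add: sum_nonneg_eq_0_iff)
  have Q0: "Q x = 0" if "D = 0" "x \<in> ?V" for x
    using that fin PQ unfolding D'[symmetric] by (simp add: sum_nonneg_eq_0_iff)
  have row: "(\<Sum>y\<in>?V. m x y) =
      (if x = u \<and> u \<notin> K then 1 else 0) + (if v \<notin> K then b x else 0) + P x" if x: "x \<in> ?V" for x
  proof -
    have "(\<Sum>y\<in>?V. P x * Q y / D) = P x"
      using P0[OF _ x] D' by (cases "D = 0") (simp_all flip: sum_divide_distrib sum_distrib_left)
    moreover have "(\<Sum>y\<in>?V. if y = v \<and> v \<notin> K then b x else 0) = (if v \<notin> K then b x else 0)"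
      using fin v(1) by auto
    moreover have "(\<Sum>y\<in>?V. if x = u \<and> u \<notin> K then a y else 0) = (if x = u \<and> u \<notin> K then 1 else 0)"
      using a(3) by auto
    ultimately show ?thesis by (simp add: m_def sum.distrib)
  qed
  have col: "(\<Sum>x\<in>?V. m x y) =
      (if u \<notin> K then a y else 0) + (if y = v \<and> v \<notin> K then 1 else 0) + Q y" if y: "y \<in> ?V" for y
  proof -
    have "(\<Sum>x\<in>?V. P x * Q y / D) = Q y"
      using Q0[OF _ y] by (cases "D = 0") (simp_all add: D_def flip: sum_divide_distrib sum_distrib_right)
    moreover have "(\<Sum>x\<in>?V. if x = u \<and> u \<notin> K then a y else 0) = (if u \<notin> K then a y else 0)"
      using fin u(1) by auto
    moreover have "(\<Sum>x\<in>?V. if y = v \<and> v \<notin> K then b x else 0) = (if y = v \<and> v \<notin> K then 1 else 0)"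
      using b(3) by auto
    ultimately show ?thesis by (simp add: m_def sum.distrib)
  qed
  have supp: "y \<in> open_nbhd G x" if "m x y \<noteq> 0" for x y
  proof -
    have "x = u \<and> u \<notin> K \<and> a y \<noteq> 0 \<or> y = v \<and> v \<notin> K \<and> b x \<noteq> 0 \<or> P x \<noteq> 0 \<and> Q y \<noteq> 0"
    proof (rule ccontr)
      assume "\<not> ?thesis"
      then have "m x y = 0" by (auto simp: m_def)
      then show False using \<open>m x y \<noteq> 0\<close> by simp
    qed
    then consider "x = u" "u \<notin> K" "a y \<noteq> 0" | "y = v" "v \<notin> K" "b x \<noteq> 0" | "P x \<noteq> 0" "Q y \<noteq> 0"
      by blast
    then show ?thesis
    proof cases
      case 3
      then have "a x > b x" "b y > a y" by (auto simp: P_def Q_def max_def split: if_splits)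
      then have "a x \<noteq> 0" "b y \<noteq> 0" "x \<noteq> y" using a(1)[of y] b(1)[of x] by auto
      then show ?thesis using a(2) b(2) clique by blast
    qed (use a(5) b(5) open_nbhd_sym[OF G] in auto)
  qed
  have nonneg: "0 \<le> m x y" for x y using a(1) b(1) PQ D0 by (simp add: m_def)
  have out: "(\<Sum>y\<in>?V. m x y) \<le> w x + indicator {u} x" if x: "x \<in> ?V" for x
    using a(1)[of x] a(4)[of x] a(6)[OF _ x] b(1)[of x] b(6)[OF _ x] w[OF x]
    unfolding row[OF x]
    by (cases "u \<in> K"; cases "v \<in> K"; auto simp: P_def max_def indicator_def)
  let ?c = "\<lambda>x. w x + indicator {u} x"
  have legal: "legal_move G ?c m"
    using G supp nonneg out by (rule move_supported_on_edges(1))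
  have after: "apply_move G ?c m x = ?c x - (\<Sum>y\<in>?V. m x y) + (\<Sum>y\<in>?V. m y x)" for x
    using G supp nonneg out by (rule move_supported_on_edges(2))
  have "apply_move G (\<lambda>x. w x + indicator {u} x) m x = w x + indicator {v} x" for x
  proof (cases "x \<in> ?V")
    case True
    then show ?thesis
      using a(4)[of x] b(4)[of x] PQ(1)[of x]
      unfolding after row[OF True] col[OF True] by (auto simp: indicator_def)
  next
    case False
    then have "open_nbhd G x = {}" using open_nbhd_subset[OF G] open_nbhd_sym[OF G] by blast
    then show ?thesis using False u(1) v(1) by (auto simp: apply_move_def indicator_def)
  qed
  then show ?thesis using legal by blast
qed

section \<open>Split graphs\<close>

text \<open>
  The new function is the image of \<open>w\<close> under the map \<open>r\<close> that sends each non-isolated independent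
  vertex to one of its neighbours and fixes all other vertices. Domination survives because \<open>r\<close> maps
  every closed neighbourhood into itself.
\<close>

lemma frac_dominating_concentrated:
  assumes G: "pair_graph G" and V: "K \<union> I = pverts G"
    and clique: "\<And>x y. x \<in> K \<Longrightarrow> y \<in> K \<Longrightarrow> x \<noteq> y \<Longrightarrow> y \<in> open_nbhd G x"
    and indep: "\<And>x. x \<in> I \<Longrightarrow> open_nbhd G x \<subseteq> K - I"
    and w: "frac_dominating G w"
  shows "\<exists>w'. frac_dominating G w' \<and> total_weight G w' = total_weight G w \<and>
    (\<forall>x\<in>I. open_nbhd G x \<noteq> {} \<longrightarrow> w' x = 0)"
proof -
  let ?V = "pverts G"
  define r where "r x = (if x \<in> I \<and> open_nbhd G x \<noteq> {} then SOME y. y \<in> open_nbhd G x else x)" for x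
  define w' where "w' y = (\<Sum>x\<in>{x \<in> ?V. r x = y}. w x)" for y
  note fin = finite_pverts[OF G]
  have w0: "0 \<le> w x" if "x \<in> ?V" for x using w that by (simp add: frac_dominating_def)
  have r_nb: "r x \<in> open_nbhd G x" if "x \<in> I" "open_nbhd G x \<noteq> {}" for x
    using that by (simp add: r_def some_in_eq)
  have r_closed: "r x \<in> closed_nbhd G z" if z: "z \<in> ?V" and x: "x \<in> closed_nbhd G z" for x z
  proof (cases "x \<in> I \<and> open_nbhd G x \<noteq> {}")
    case True
    then have rx: "r x \<in> open_nbhd G x" "r x \<in> K" using r_nb indep by auto
    show ?thesis
    proof (cases "x = z")
      case False
      then have "z \<in> K" using True x indep open_nbhd_sym[OF G] by (auto simp: closed_nbhd_def)
      then show ?thesis using clique rx by (auto simp: closed_nbhd_def)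
    qed (use rx in \<open>simp add: closed_nbhd_def\<close>)
  qed (use x in \<open>auto simp: r_def\<close>)
  have r_V: "r x \<in> ?V" if "x \<in> ?V" for x
    using r_closed[OF that, of x] closed_nbhd_subset[OF G that] by (auto simp: closed_nbhd_def)
  have "1 \<le> (\<Sum>y\<in>closed_nbhd G z. w' y)" if z: "z \<in> ?V" for z
  proof -
    have sub: "closed_nbhd G z \<subseteq> ?V" by (rule closed_nbhd_subset[OF G z])
    have "1 \<le> (\<Sum>x\<in>closed_nbhd G z. w x)" using w z by (simp add: frac_dominating_def)
    also have "\<dots> \<le> (\<Sum>x\<in>{x \<in> ?V. r x \<in> closed_nbhd G z}. w x)"
      using fin sub r_closed[OF z] w0 by (intro sum_mono2) auto
    also have "\<dots> = (\<Sum>y\<in>closed_nbhd G z. \<Sum>x\<in>{x \<in> {x \<in> ?V. r x \<in> closed_nbhd G z}. r x = y}. w x)"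
      using fin finite_closed_nbhd[OF G] by (subst sum.group) auto
    also have "\<dots> = (\<Sum>y\<in>closed_nbhd G z. w' y)"
      unfolding w'_def by (intro sum.cong refl arg_cong[where f="sum w"]) auto
    finally show ?thesis .
  qed
  moreover have "0 \<le> w' x" for x unfolding w'_def using w0 by (auto intro: sum_nonneg)
  moreover have "total_weight G w' = total_weight G w"
    unfolding total_weight_def w'_def using fin r_V by (intro sum.group) auto
  moreover have "w' y = 0" if y: "y \<in> I" "open_nbhd G y \<noteq> {}" for y
  proof -
    have "r x \<noteq> y" for x
      using y r_nb[of x] indep[of x] by (cases "x \<in> I \<and> open_nbhd G x \<noteq> {}") (auto simp: r_def)
    then show ?thesis by (simp add: w'_def)
  qed
  ultimately show ?thesis unfolding frac_dominating_def by blast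
qed

lemma eternally_frac_dominated_split_graph:
  assumes G: "pair_graph G" and split: "split_graph G"
  shows "eternally_frac_dominated G (1 + frac_dom_number G)"
proof -
  obtain K I where KI: "K \<union> I = pverts G" "K \<inter> I = {}"
    and K: "\<forall>x\<in>K. \<forall>y\<in>K. x \<noteq> y \<longrightarrow> (x, y) \<in> parcs G"
    and I: "\<forall>x\<in>I. \<forall>y\<in>I. (x, y) \<notin> parcs G"
    using split unfolding split_graph_def by blast
  have clique: "y \<in> open_nbhd G x" if "x \<in> K" "y \<in> K" "x \<noteq> y" for x y
    using K that by (simp add: open_nbhd_def)
  have indep: "open_nbhd G x \<subseteq> K - I" if "x \<in> I" for x
    using I that KI open_nbhd_subset[OF G, of x] by (auto simp: open_nbhd_def)
  obtain w where w: "frac_dominating G w" "total_weight G w = frac_dom_number G"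
    and zero: "\<And>x. x \<in> I \<Longrightarrow> open_nbhd G x \<noteq> {} \<Longrightarrow> w x = 0"
    using frac_dom_number_attained(1)[OF G] frac_dominating_concentrated[OF G KI(1) clique indep]
    by metis
  have w0: "0 \<le> w x" if "x \<in> pverts G" for x using w that by (simp add: frac_dominating_def)
  define T where "T = K \<union> {x \<in> I. open_nbhd G x \<noteq> {}}"
  define tok where "tok u = (\<lambda>x. w x + indicator {u} x)" for u
  have T_V: "T \<subseteq> pverts G" using KI by (auto simp: T_def)
  have isolated: "w x \<ge> 1" if "x \<in> pverts G" "x \<notin> T" for x
  proof -
    have "closed_nbhd G x = {x}" using that KI by (auto simp: T_def closed_nbhd_def)
    then show ?thesis using w(1) that by (fastforce simp: frac_dominating_def)
  qed
  have share: "\<exists>a. token_share G K w u a" if "u \<in> T" for u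
  proof (cases "u \<in> K")
    case True
    then show ?thesis using token_share_clique_vertex[OF G] KI by blast
  next
    case False
    then have "u \<in> I" "open_nbhd G u \<noteq> {}" using that by (auto simp: T_def)
    then show ?thesis
      using False that T_V zero indep by (intro token_share_independent_vertex[OF G w(1)]) auto
  qed
  have relocate: "\<exists>m. legal_move G (tok u) m \<and> apply_move G (tok u) m = tok v"
    if "u \<in> T" "v \<in> T" for u v
  proof -
    obtain a b where ab: "token_share G K w u a" "token_share G K w v b"
      using share[OF \<open>u \<in> T\<close>] share[OF \<open>v \<in> T\<close>] by blast
    show ?thesis
      unfolding tok_def using KI(1) T_V that
      by (intro token_relocation[OF G _ clique w0 _ ab(1) _ ab(2)]) auto
  qed
  have dom: "frac_dominating G (tok u)" for u
    unfolding frac_dominating_def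
  proof (intro conjI ballI)
    fix v assume v: "v \<in> pverts G"
    show "0 \<le> tok u v" using w0[OF v] by (simp add: tok_def)
    have "1 \<le> (\<Sum>x\<in>closed_nbhd G v. w x)" using w(1) v by (simp add: frac_dominating_def)
    also have "\<dots> \<le> (\<Sum>x\<in>closed_nbhd G v. tok u x)" by (intro sum_mono) (simp add: tok_def)
    finally show "1 \<le> (\<Sum>x\<in>closed_nbhd G v. tok u x)" .
  qed
  have weight: "total_weight G (tok u) = 1 + frac_dom_number G" if "u \<in> T" for u
  proof -
    have "(\<Sum>x\<in>pverts G. indicator {u} x :: real) = 1"
      using that T_V finite_pverts[OF G] by (auto simp: indicator_def)
    then show ?thesis using w(2) by (simp add: total_weight_def tok_def sum.distrib)
  qed
  have stay: "legal_move G c (\<lambda>_ _. 0) \<and> apply_move G c (\<lambda>_ _. 0) = c"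
    if "\<And>x. x \<in> pverts G \<Longrightarrow> 0 \<le> c x" for c
    using that by (simp add: legal_move_def apply_move_def fun_eq_iff)
  show ?thesis
  proof (cases "T = {}")
    \<comment> \<open>Without an admissible place for the token there are no edges, and \<open>w\<close> alone guards every vertex.\<close>
    case True
    show ?thesis
    proof (rule eternally_frac_dominated_invariant)
      show "w \<in> {w}" "total_weight G w \<le> 1 + frac_dom_number G" using w by auto
    next
      fix c v assume "c \<in> {w}" "v \<in> pverts G"
      moreover have "legal_move G w (\<lambda>_ _. 0) \<and> apply_move G w (\<lambda>_ _. 0) = w"
        using w0 by (rule stay)
      ultimately show "\<exists>m. legal_move G c m \<and> apply_move G c m \<in> {w} \<and> apply_move G c m v \<ge> 1"
        using isolated True by (intro exI[of _ "\<lambda>_ _. 0"]) auto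
    qed (use w in auto)
  next
    case False
    then obtain u0 where u0: "u0 \<in> T" by blast
    show ?thesis
    proof (rule eternally_frac_dominated_invariant)
      show "tok u0 \<in> tok ` T" "total_weight G (tok u0) \<le> 1 + frac_dom_number G"
        using u0 weight by auto
    next
      fix c v assume "c \<in> tok ` T" and v: "v \<in> pverts G"
      then obtain u where u: "u \<in> T" "c = tok u" by blast
      show "\<exists>m. legal_move G c m \<and> apply_move G c m \<in> tok ` T \<and> apply_move G c m v \<ge> 1"
      proof (cases "v \<in> T")
        case True
        moreover have "tok v v \<ge> 1" using w0[OF v] by (simp add: tok_def)
        ultimately show ?thesis using relocate[of u v] u by (metis imageI)
      next
        case False
        have "tok u v \<ge> 1" using isolated[OF v False] by (simp add: tok_def add_increasing2)
        moreover have "0 \<le> tok u x" if "x \<in> pverts G" for x using w0[OF that] by (simp add: tok_def)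
        ultimately show ?thesis using stay[of c] u by (metis imageI)
      qed
    qed (use dom in auto)
  qed
qed

theorem theorem4p5:
  fixes G :: "'a pair_pre_digraph"
  assumes "pair_graph G" and "split_graph G"
  shows "frac_dom_number G \<le> eternal_frac_dom_number G \<and>
         eternal_frac_dom_number G \<le> 1 + frac_dom_number G"
proof
  show "frac_dom_number G \<le> eternal_frac_dom_number G"
    by (rule frac_dom_number_le_eternal_frac_dom_number[OF assms(1)])
  show "eternal_frac_dom_number G \<le> 1 + frac_dom_number G"
    unfolding eternal_frac_dom_number_def
    using eternally_frac_dominated_split_graph[OF assms] bdd_below_eternally_frac_dominated
    by (intro cInf_lower) auto
qed

end
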